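(* Let $A,B$ be bounded positive operators on the complex Hilbert space $H$. Let $S_A,S_B:H_{A+B}\to H$ be the contractions determined by $S_A((A+B)x)=A^{1/2}x$ and $S_B((A+B)x)=B^{1/2}x$, $x\in H$. Then $$A:B=A^{1/2}S_AS_B^*B^{1/2}=B^{1/2}S_BS_A^*A^{1/2}.$$
   Context: Inner products are linear in the first variable. A bounded operator $A$ on $H$ is positive if $(Ax\mid x)\ge0$ for all $x\in H$. For a bounded positive operator $C$ on $H$, $H_C$ denotes the Hilbert space completion of $\operatorname{ran}C$ equipped with the inner product $(Cx\mid Cy)_C:=(Cx\mid y)$, $x,y\in H$; here $C=A+B$. The operators $S_A,S_B$, given on the dense subspace $\operatorname{ran}(A+B)$ of $H_{A+B}$, are contractive and extended by continuity to all of $H_{A+B}$. The parallel sum $A:B$ is the unique bounded positive operator on $H$ with quadratic form $$((A:B)x\mid x)=\inf\{(A(x-y)\mid x-y)+(By\mid y):y\in H\},\qquad x\in H.$$ *)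

theory Defs
  imports "HOL-Analysis.Analysis"
begin

text \<open>
  The inner product is linear in its first argument.  The real normed vector space structure
  is the underlying one, so that limits, closures and completeness are those of the library.
\<close>

class complex_inner = real_normed_vector +
  fixes scaleC :: "complex \<Rightarrow> 'a \<Rightarrow> 'a"  (infixr \<open>*\<^sub>C\<close> 75)
    and cinner :: "'a \<Rightarrow> 'a \<Rightarrow> complex"
  assumes scaleC_add_right: "a *\<^sub>C (x + y) = a *\<^sub>C x + a *\<^sub>C y"
    and scaleC_add_left: "(a + b) *\<^sub>C x = a *\<^sub>C x + b *\<^sub>C x"
    and scaleC_scaleC: "a *\<^sub>C (b *\<^sub>C x) = (a * b) *\<^sub>C x"
    and scaleC_one: "1 *\<^sub>C x = x"
    and scaleR_scaleC: "scaleR r x = complex_of_real r *\<^sub>C x"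
    and cinner_add_left: "cinner (x + y) z = cinner x z + cinner y z"
    and cinner_scaleC_left: "cinner (a *\<^sub>C x) y = a * cinner x y"
    and cinner_commute: "cinner x y = cnj (cinner y x)"
    and cinner_self_nonneg: "cinner x x \<in> \<real>\<^sub>\<ge>\<^sub>0"
    and norm_eq_sqrt_cinner: "norm x = sqrt (Re (cinner x x))"

class chilbert_space = complex_inner + complete_space

definition bounded_clinear :: "('a::complex_inner \<Rightarrow> 'b::complex_inner) \<Rightarrow> bool" where
  "bounded_clinear T \<longleftrightarrow> bounded_linear T \<and> (\<forall>c x. T (c *\<^sub>C x) = c *\<^sub>C T x)"

definition positive_op :: "('a::chilbert_space \<Rightarrow> 'a) \<Rightarrow> bool" where
  "positive_op A \<longleftrightarrow> bounded_clinear A \<and> (\<forall>x. cinner (A x) x \<in> \<real>\<^sub>\<ge>\<^sub>0)"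

definition sqrt_op :: "('a::chilbert_space \<Rightarrow> 'a) \<Rightarrow> 'a \<Rightarrow> 'a" where
  "sqrt_op A = (THE R. positive_op R \<and> R \<circ> R = A)"

definition parallel_sum ::
    "('a::chilbert_space \<Rightarrow> 'a) \<Rightarrow> ('a \<Rightarrow> 'a) \<Rightarrow> 'a \<Rightarrow> 'a" where
  "parallel_sum A B = (THE P. positive_op P \<and>
     (\<forall>x. cinner (P x) x =
        complex_of_real (INF y. Re (cinner (A (x - y)) (x - y) + cinner (B y) y))))"

text \<open>
  \<open>K\<close>, with the embedding \<open>j\<close> of \<open>ran C\<close>, is a Hilbert space completion \<open>H\<^sub>C\<close> of \<open>ran C\<close> for
  the inner product \<open>(C x | C y)\<^sub>C = (C x | y)\<close>.  As the completion depends on the operator \<open>C\<close>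
  it is not a type: it is a closed subspace of some complex Hilbert space (possibly all of it).
  The values of \<open>j\<close> outside \<open>ran C\<close> are irrelevant.
\<close>

definition range_completion ::
    "('a::chilbert_space \<Rightarrow> 'a) \<Rightarrow> 'k::chilbert_space set \<Rightarrow> ('a \<Rightarrow> 'k) \<Rightarrow> bool" where
  "range_completion C K j \<longleftrightarrow>
     (\<forall>u\<in>range C. \<forall>v\<in>range C. j (u + v) = j u + j v) \<and>
     (\<forall>c. \<forall>u\<in>range C. j (c *\<^sub>C u) = c *\<^sub>C j u) \<and>
     (\<forall>x y. cinner (j (C x)) (j (C y)) = cinner (C x) y) \<and>
     closure (j ` range C) = K"

definition contraction_on ::
    "'k::chilbert_space set \<Rightarrow> ('k \<Rightarrow> 'a::chilbert_space) \<Rightarrow> bool" where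
  "contraction_on K S \<longleftrightarrow>
     (\<forall>u\<in>K. \<forall>v\<in>K. S (u + v) = S u + S v) \<and>
     (\<forall>c. \<forall>u\<in>K. S (c *\<^sub>C u) = c *\<^sub>C S u) \<and>
     (\<forall>u\<in>K. norm (S u) \<le> norm u)"

text \<open>
  The contraction \<open>H\<^sub>C \<rightarrow> H\<close> with \<open>C x \<mapsto> A\<^sup>1\<^sup>/\<^sup>2 x\<close>.  As a function on the whole ambient type it is
  unique only after fixing its values outside \<open>K\<close>, hence the condition \<open>extensional K\<close>.
\<close>

definition sqrt_contraction ::
    "('a::chilbert_space \<Rightarrow> 'a) \<Rightarrow> 'k::chilbert_space set \<Rightarrow> ('a \<Rightarrow> 'k) \<Rightarrow> ('a \<Rightarrow> 'a) \<Rightarrow> 'k \<Rightarrow> 'a" where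
  "sqrt_contraction C K j A =
     (THE S. S \<in> extensional K \<and> contraction_on K S \<and> (\<forall>x. S (j (C x)) = sqrt_op A x))"

text \<open>The Hilbert space adjoint \<open>H \<rightarrow> K\<close> of an operator \<open>S : K \<rightarrow> H\<close>.\<close>

definition adjoint_on ::
    "'k::chilbert_space set \<Rightarrow> ('k \<Rightarrow> 'a::chilbert_space) \<Rightarrow> 'a \<Rightarrow> 'k" where
  "adjoint_on K S y = (THE u. u \<in> K \<and> (\<forall>k\<in>K. cinner (S k) y = cinner k u))"

end

theory Submission imports Defs begin

text \<open>
  Write \<open>C = A + B\<close>, \<open>a x = S\<^sub>A\<^sup>* A\<^sup>1\<^sup>/\<^sup>2 x\<close> and \<open>b x = S\<^sub>B\<^sup>* B\<^sup>1\<^sup>/\<^sup>2 x\<close>.  Testing against the dense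
  range of \<open>C\<close> gives \<open>a x + b x = C x\<close> in \<open>H\<^sub>C\<close> and \<open>(b x | C z)\<^sub>C = (B x | z)\<close>, so that the form of
  \<open>A\<^sup>1\<^sup>/\<^sup>2 S\<^sub>A S\<^sub>B\<^sup>* B\<^sup>1\<^sup>/\<^sup>2\<close> is \<open>(b x | a x) = (B x | x) - \<parallel>b x\<parallel>\<^sup>2\<close>.  On the other hand, with \<open>z = x - y\<close>,
  the quantity whose infimum defines the parallel sum is
  \<open>\<parallel>b x - C z\<parallel>\<^sup>2 + (B x | x) - \<parallel>b x\<parallel>\<^sup>2\<close>, whose first term becomes arbitrarily small by density.
\<close>

text \<open>Gives completeness of the space of bounded operators, in which the square root iteration
  converges.\<close>

instance chilbert_space \<subseteq> banach ..

section \<open>Complex inner product spaces\<close>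

lemma scaleC_minus_one [simp]: "(-1) *\<^sub>C x = - (x::'a::complex_inner)"
  using scaleR_scaleC[of "-1" x] by simp

lemma scaleC_zero_right [simp]: "a *\<^sub>C 0 = (0::'a::complex_inner)"
  using scaleC_add_right[of a 0 "0::'a"] by simp

lemma scaleC_minus_right: "a *\<^sub>C (- x) = - (a *\<^sub>C (x::'a::complex_inner))"
  using scaleC_add_right[of a x "- x"] by (simp add: eq_neg_iff_add_eq_0 add.commute)

lemma scaleC_diff_right: "a *\<^sub>C (x - y) = a *\<^sub>C x - a *\<^sub>C (y::'a::complex_inner)"
  using scaleC_add_right[of a x "- y"] by (simp add: scaleC_minus_right)

lemma scaleC_scaleR: "a *\<^sub>C (r *\<^sub>R x) = r *\<^sub>R (a *\<^sub>C (x::'a::complex_inner))"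
  by (simp add: scaleR_scaleC scaleC_scaleC mult.commute)

lemma cinner_add_right: "cinner x (y + z) = cinner x y + cinner x (z::'a::complex_inner)"
  by (metis cinner_commute cinner_add_left complex_cnj_add)

lemma cinner_scaleC_right: "cinner x (a *\<^sub>C y) = cnj a * cinner x (y::'a::complex_inner)"
  by (metis cinner_commute cinner_scaleC_left complex_cnj_mult)

lemma cinner_scaleR_left: "cinner (r *\<^sub>R x) y = r *\<^sub>R cinner x (y::'a::complex_inner)"
  by (simp add: scaleR_scaleC cinner_scaleC_left scaleR_conv_of_real)

lemma cinner_scaleR_right: "cinner x (r *\<^sub>R y) = r *\<^sub>R cinner x (y::'a::complex_inner)"
  by (simp add: scaleR_scaleC cinner_scaleC_right scaleR_conv_of_real)

lemma cinner_minus_left: "cinner (- x) y = - cinner x (y::'a::complex_inner)"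
  using cinner_scaleR_left[of "-1" x y] by simp

lemma cinner_minus_right: "cinner x (- y) = - cinner x (y::'a::complex_inner)"
  using cinner_scaleR_right[of x "-1" y] by simp

lemma cinner_diff_left: "cinner (x - y) z = cinner x z - cinner y (z::'a::complex_inner)"
  using cinner_add_left[of x "- y" z] by (simp add: cinner_minus_left)

lemma cinner_diff_right: "cinner x (y - z) = cinner x y - cinner x (z::'a::complex_inner)"
  using cinner_add_right[of x y "- z"] by (simp add: cinner_minus_right)

lemma cinner_zero_left [simp]: "cinner 0 (y::'a::complex_inner) = 0"
  using cinner_scaleR_left[of 0 0 y] by simp

lemma cinner_zero_right [simp]: "cinner (x::'a::complex_inner) 0 = 0"
  using cinner_scaleR_right[of x 0 0] by simp

lemma cinner_self: "cinner x x = complex_of_real ((norm (x::'a::complex_inner))\<^sup>2)"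
  using cinner_self_nonneg[of x]
  by (auto simp: complex_nonneg_Reals_iff norm_eq_sqrt_cinner complex_eq_iff)

lemma power2_norm_add:
  "(norm (x + y :: 'a::complex_inner))\<^sup>2 = (norm x)\<^sup>2 + 2 * Re (cinner x y) + (norm y)\<^sup>2"
proof -
  have "Re (cinner y x) = Re (cinner x y)"
    by (subst cinner_commute) simp
  then have "Re (cinner (x + y) (x + y)) = Re (cinner x x) + 2 * Re (cinner x y) + Re (cinner y y)"
    by (simp add: cinner_add_left cinner_add_right)
  then show ?thesis
    by (simp add: cinner_self)
qed

lemma power2_norm_diff:
  "(norm (x - y :: 'a::complex_inner))\<^sup>2 = (norm x)\<^sup>2 - 2 * Re (cinner x y) + (norm y)\<^sup>2"
  using power2_norm_add[of x "- y"] by (simp add: cinner_minus_right)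

lemma parallelogram_law:
  "(norm (x + y :: 'a::complex_inner))\<^sup>2 + (norm (x - y))\<^sup>2 = 2 * (norm x)\<^sup>2 + 2 * (norm y)\<^sup>2"
  by (simp add: power2_norm_add power2_norm_diff)

lemma cinner_eqI: "(\<And>z. cinner x z = cinner y z) \<Longrightarrow> x = (y::'a::complex_inner)"
  using cinner_self[of "x - y"] by (simp add: cinner_diff_left)

section \<open>Nonnegative sesquilinear forms: symmetry and Cauchy-Schwarz\<close>

context
  fixes A :: "'a::complex_inner \<Rightarrow> 'a"
  assumes add: "\<And>x y. A (x + y) = A x + A y"
    and scale: "\<And>c x. A (c *\<^sub>C x) = c *\<^sub>C A x"
    and nonneg: "\<And>x. cinner (A x) x \<in> \<real>\<^sub>\<ge>\<^sub>0"
begin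

text \<open>Polarisation: the form is real at \<open>x + y\<close>, which relates the imaginary
  parts of the two mixed terms, and real at \<open>x + \<i> *\<^sub>C y\<close>, which relates their
  real parts.\<close>

lemma nonneg_form_hermitian: "cinner (A x) y = cnj (cinner (A y) x)"
proof -
  have real: "Im (cinner (A z) z) = 0" for z
    using nonneg[of z] by (simp add: complex_nonneg_Reals_iff)
  have "Im (cinner (A x) y) = - Im (cinner (A y) x)"
    using real[of "x + y"] real[of x] real[of y]
    by (simp add: add cinner_add_left cinner_add_right)
  moreover have "Re (cinner (A x) y) = Re (cinner (A y) x)"
    using real[of "x + \<i> *\<^sub>C y"] real[of x] real[of y]
    by (simp add: add scale cinner_add_left cinner_add_right cinner_scaleC_left cinner_scaleC_right)
  ultimately show ?thesis
    by (simp add: complex_eq_iff)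
qed

text \<open>Nonnegativity along \<open>x - t h y\<close>, with \<open>t\<close> real and
  \<open>h\<close> the mixed term, gives a real quadratic in \<open>t\<close>: the factor
  \<open>h\<close> turns the cross terms into multiples of the squared modulus of \<open>h\<close>.
  The form may be degenerate, so \<open>r = 0\<close> is treated apart. Later uses are the inner
  product itself, a positive operator, and the difference of two operators.\<close>

lemma nonneg_form_Cauchy_Schwarz:
  "(cmod (cinner (A x) y))\<^sup>2 \<le> Re (cinner (A x) x) * Re (cinner (A y) y)"
proof -
  define h q r where "h = cinner (A x) y" and "q = Re (cinner (A x) x)" and "r = Re (cinner (A y) y)"
  have im: "Im (cinner (A y) y) = 0" and r0: "0 \<le> r"
    using nonneg[of y] by (simp_all add: complex_nonneg_Reals_iff r_def)
  have key: "0 \<le> q - 2 * t * (cmod h)\<^sup>2 + t\<^sup>2 * (cmod h)\<^sup>2 * r" for t :: real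
  proof -
    define c where "c = - complex_of_real t * h"
    have yx: "cinner (A y) x = cnj h"
      by (simp add: nonneg_form_hermitian[of y x] h_def)
    have "cinner (A (x + c *\<^sub>C y)) (x + c *\<^sub>C y)
        = cinner (A x) x + cnj c * h + c * cnj h + (c * cnj c) * cinner (A y) y"
      by (simp add: add scale cinner_add_left cinner_add_right cinner_scaleC_left
          cinner_scaleC_right yx h_def algebra_simps)
    also have "Re \<dots> = q - 2 * t * (cmod h)\<^sup>2 + t\<^sup>2 * (cmod h)\<^sup>2 * r"
      using im unfolding cmod_power2 c_def q_def r_def
      by (simp add: power2_eq_square algebra_simps)
    finally show ?thesis
      using nonneg[of "x + c *\<^sub>C y"] by (simp add: complex_nonneg_Reals_iff)
  qed
  have "(cmod h)\<^sup>2 \<le> q * r"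
  proof (cases "r = 0")
    case True
    have "(cmod h)\<^sup>2 = 0"
    proof (rule ccontr)
      assume "(cmod h)\<^sup>2 \<noteq> 0"
      \<comment> \<open>With \<open>r = 0\<close> this \<open>t\<close> makes the right-hand side of
        \<open>key\<close> equal to \<open>q - (q + 1) = -1\<close>.\<close>
      then show False
        using key[of "(q + 1) / (2 * (cmod h)\<^sup>2)"] True by (simp add: field_simps)
    qed
    then show ?thesis using True by simp
  next
    case False
    then have "0 < r" using r0 by simp
    have "0 \<le> q - (cmod h)\<^sup>2 / r"
      using key[of "1 / r"] False by (simp add: power2_eq_square field_simps)
    then show ?thesis
      using \<open>0 < r\<close> by (simp add: field_simps)
  qed
  then show ?thesis by (simp add: h_def q_def r_def)
qed

end

lemma Cauchy_Schwarz_cinner: "cmod (cinner x y) \<le> norm x * norm (y::'a::complex_inner)"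
proof -
  have "(cmod (cinner x y))\<^sup>2 \<le> (norm x * norm y)\<^sup>2"
    using nonneg_form_Cauchy_Schwarz[of "\<lambda>x. x" x y]
    by (simp add: cinner_self_nonneg cinner_self power_mult_distrib)
  then show ?thesis
    by (rule power2_le_imp_le) simp
qed

lemma bounded_bilinear_cinner:
  "bounded_bilinear (cinner :: 'a::complex_inner \<Rightarrow> 'a \<Rightarrow> complex)"
  by standard
    (auto simp: cinner_add_left cinner_add_right cinner_scaleR_left cinner_scaleR_right
      intro!: exI[of _ 1] Cauchy_Schwarz_cinner)

lemmas tendsto_cinner = bounded_bilinear.tendsto[OF bounded_bilinear_cinner]

lemma norm_scaleC: "norm (a *\<^sub>C x) = cmod a * norm (x::'a::complex_inner)"
proof -
  have "complex_of_real ((norm (a *\<^sub>C x))\<^sup>2) = (a * cnj a) * complex_of_real ((norm x)\<^sup>2)"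
    unfolding cinner_self[symmetric] by (simp add: cinner_scaleC_left cinner_scaleC_right)
  also have "\<dots> = complex_of_real ((cmod a * norm x)\<^sup>2)"
    by (simp add: complex_norm_square[symmetric] power_mult_distrib)
  finally have "(norm (a *\<^sub>C x))\<^sup>2 = (cmod a * norm x)\<^sup>2"
    by (simp only: of_real_eq_iff)
  then show ?thesis
    by (simp add: power2_eq_iff_nonneg)
qed

lemma bounded_linear_scaleC: "bounded_linear (scaleC a :: 'a::complex_inner \<Rightarrow> 'a)"
  by (rule bounded_linear_intro[of _ "cmod a"])
    (simp_all add: scaleC_add_right scaleC_scaleR norm_scaleC)

lemmas tendsto_scaleC = bounded_linear.tendsto[OF bounded_linear_scaleC]

section \<open>Positive operators and their square roots\<close>

lemma bounded_clinearI:
  assumes "\<And>x y. T (x + y) = T x + T y" "\<And>c x. T (c *\<^sub>C x) = c *\<^sub>C T x"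
    "\<And>x. norm (T x) \<le> norm x * M"
  shows "bounded_clinear T"
  unfolding bounded_clinear_def
  using assms by (auto simp: scaleR_scaleC intro!: bounded_linear_intro[of _ M])

lemma bounded_clinear_add: "bounded_clinear T \<Longrightarrow> T (x + y) = T x + T y"
  by (simp add: bounded_clinear_def linear_add bounded_linear.linear)

lemma bounded_clinear_diff: "bounded_clinear T \<Longrightarrow> T (x - y) = T x - T y"
  by (simp add: bounded_clinear_def linear_diff bounded_linear.linear)

lemma bounded_clinear_scaleC: "bounded_clinear T \<Longrightarrow> T (c *\<^sub>C x) = c *\<^sub>C T x"
  by (simp add: bounded_clinear_def)

lemma bounded_clinear_compose:
  "bounded_clinear S \<Longrightarrow> bounded_clinear T \<Longrightarrow> bounded_clinear (S \<circ> T)"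
  by (auto simp: bounded_clinear_def o_def intro: bounded_linear_compose)

lemma positive_op_bounded_clinear: "positive_op A \<Longrightarrow> bounded_clinear A"
  by (simp add: positive_op_def)

lemma positive_op_nonneg: "positive_op A \<Longrightarrow> cinner (A x) x \<in> \<real>\<^sub>\<ge>\<^sub>0"
  by (simp add: positive_op_def)

lemma positive_op_Re_nonneg: "positive_op A \<Longrightarrow> 0 \<le> Re (cinner (A x) x)"
  using positive_op_nonneg[of A x] by (simp add: complex_nonneg_Reals_iff)

lemma positive_op_Im: "positive_op A \<Longrightarrow> Im (cinner (A x) x) = 0"
  using positive_op_nonneg[of A x] by (simp add: complex_nonneg_Reals_iff)

lemma positive_op_Cauchy_Schwarz:
  "positive_op A \<Longrightarrow> (cmod (cinner (A x) y))\<^sup>2 \<le> Re (cinner (A x) x) * Re (cinner (A y) y)"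
  by (rule nonneg_form_Cauchy_Schwarz)
    (auto simp: positive_op_def bounded_clinear_add bounded_clinear_scaleC)

lemma positive_op_selfadjoint: "positive_op A \<Longrightarrow> cinner (A x) y = cinner x (A y)"
proof -
  assume "positive_op A"
  then have "cinner (A x) y = cnj (cinner (A y) x)"
    by (intro nonneg_form_hermitian)
      (auto simp: positive_op_def bounded_clinear_add bounded_clinear_scaleC)
  then show ?thesis
    using cinner_commute[of x "A y"] by simp
qed

text \<open>The difference \<open>S - T\<close> has zero diagonal form, so Cauchy-Schwarz applies to
  it and forces every mixed term to vanish. Uniqueness of the parallel sum rests on this.\<close>

lemma bounded_clinear_eqI:
  assumes S: "bounded_clinear S" and T: "bounded_clinear T"
    and eq: "\<And>x. cinner (S x) x = cinner (T x) x"
  shows "S = T"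
proof
  fix x
  have "(cmod (cinner (S x - T x) y))\<^sup>2 \<le> Re (cinner (S x - T x) x) * Re (cinner (S y - T y) y)" for y
    by (rule nonneg_form_Cauchy_Schwarz)
      (simp_all add: bounded_clinear_add[OF S] bounded_clinear_add[OF T] eq cinner_diff_left
        bounded_clinear_scaleC[OF S] bounded_clinear_scaleC[OF T] scaleC_diff_right)
  then have "cinner (S x) y = cinner (T x) y" for y
    by (simp add: eq cinner_diff_left)
  then show "S x = T x"
    by (rule cinner_eqI)
qed

text \<open>Cauchy-Schwarz with \<open>y = A x\<close> bounds the fourth power of
  \<open>norm (A x)\<close> by the form at \<open>x\<close> times the form at \<open>A x\<close>.
  The latter is at most \<open>b * (norm (A x))\<^sup>2\<close>, and one factor
  \<open>(norm (A x))\<^sup>2\<close> cancels. In operator terms, the square of \<open>A\<close> is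
  at most \<open>b A\<close>.\<close>

lemma positive_op_power2_norm_le:
  assumes A: "positive_op A" and b: "\<And>x. norm (A x) \<le> norm x * b"
  shows "(norm (A x))\<^sup>2 \<le> b * Re (cinner (A x) x)"
proof (cases "A x = 0")
  case True
  then show ?thesis by simp
next
  case False
  define n where "n = (norm (A x))\<^sup>2"
  have "0 < n" using False by (simp add: n_def)
  have "n\<^sup>2 \<le> Re (cinner (A x) x) * Re (cinner (A (A x)) (A x))"
    using positive_op_Cauchy_Schwarz[OF A, of x "A x"] by (simp add: cinner_self n_def norm_power)
  also have "\<dots> \<le> Re (cinner (A x) x) * (n * b)"
  proof (rule mult_left_mono)
    have "Re (cinner (A (A x)) (A x)) \<le> norm (A (A x)) * norm (A x)"
      by (meson Cauchy_Schwarz_cinner complex_Re_le_cmod order_trans)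
    also have "\<dots> \<le> (norm (A x) * b) * norm (A x)"
      by (intro mult_right_mono b) simp
    finally show "Re (cinner (A (A x)) (A x)) \<le> n * b"
      by (simp add: n_def power2_eq_square mult_ac)
  qed (rule positive_op_Re_nonneg[OF A])
  finally have "n * n \<le> n * (b * Re (cinner (A x) x))"
    by (simp add: power2_eq_square mult_ac)
  then show ?thesis
    unfolding mult_le_cancel_left_pos[OF \<open>0 < n\<close>] by (simp add: n_def)
qed

lemma positive_op_eq_0:
  assumes "positive_op A" "Re (cinner (A x) x) = 0"
  shows "A x = 0"
proof -
  obtain b where "\<And>x. norm (A x) \<le> norm x * b"
    using assms(1) bounded_linear.bounded[of A]
    by (auto simp: positive_op_def bounded_clinear_def)
  then show ?thesis
    using positive_op_power2_norm_le[OF assms(1), of b x] assms(2) by simp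
qed

section \<open>Convergence of the iteration for the square root\<close>

primrec sqrt_iter :: "('a::real_normed_vector \<Rightarrow>\<^sub>L 'a) \<Rightarrow> nat \<Rightarrow> ('a \<Rightarrow>\<^sub>L 'a)" where
  "sqrt_iter X 0 = 0"
| "sqrt_iter X (Suc n) = (1/2) *\<^sub>R (X + (sqrt_iter X n o\<^sub>L sqrt_iter X n))"

text \<open>The same iteration for the scalar 1 in place of \<open>X\<close>. It is increasing and
  bounded by 1, and its increments will dominate those of \<open>sqrt_iter\<close>.\<close>

primrec sqrt_majorant :: "nat \<Rightarrow> real" where
  "sqrt_majorant 0 = 0"
| "sqrt_majorant (Suc n) = (1 + (sqrt_majorant n)\<^sup>2) / 2"

lemma sqrt_majorant_nonneg: "0 \<le> sqrt_majorant n"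
  by (induction n) auto

lemma sqrt_majorant_le_1: "sqrt_majorant n \<le> 1"
proof (induction n)
  case (Suc n)
  then show ?case
    using power_mono[OF Suc sqrt_majorant_nonneg, of 2] by simp
qed simp

lemma sqrt_majorant_Suc_ge: "sqrt_majorant n \<le> sqrt_majorant (Suc n)"
  using zero_le_power2[of "sqrt_majorant n - 1"] by (simp add: power2_diff)

context
  fixes X :: "'a::banach \<Rightarrow>\<^sub>L 'a"
  assumes norm_X: "norm X \<le> 1"
begin

lemma norm_sqrt_iter_le: "norm (sqrt_iter X n) \<le> sqrt_majorant n"
proof (induction n)
  case (Suc n)
  have "norm (sqrt_iter X n o\<^sub>L sqrt_iter X n) \<le> norm (sqrt_iter X n) * norm (sqrt_iter X n)"
    by (rule norm_blinfun_compose)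
  also have "\<dots> \<le> sqrt_majorant n * sqrt_majorant n"
    by (intro mult_mono Suc sqrt_majorant_nonneg) simp
  finally show ?case
    using norm_X norm_triangle_ineq[of X "sqrt_iter X n o\<^sub>L sqrt_iter X n"]
    by (simp add: power2_eq_square)
qed simp

text \<open>A difference of squares splits as \<open>Y' D + D Y\<close> with
  \<open>D = Y' - Y\<close> even when \<open>Y\<close> and \<open>Y'\<close> do not commute. Taking
  norms gives the scalar expression \<open>(y' + y) (y' - y)\<close>, which is the difference of
  squares for the majorant, so the induction closes without loss.\<close>

lemma norm_sqrt_iter_diff_le:
  "norm (sqrt_iter X (Suc n) - sqrt_iter X n) \<le> sqrt_majorant (Suc n) - sqrt_majorant n"
proof (induction n)
  case 0
  then show ?case using norm_X by simp
next
  case (Suc n)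
  let ?Y = "sqrt_iter X" and ?y = sqrt_majorant
  define D where "D = ?Y (Suc n) - ?Y n"
  have "?Y (Suc (Suc n)) - ?Y (Suc n)
      = (1/2) *\<^sub>R ((?Y (Suc n) o\<^sub>L ?Y (Suc n)) - (?Y n o\<^sub>L ?Y n))"
    by (simp only: sqrt_iter.simps(2)[of X "Suc n"] sqrt_iter.simps(2)[of X n]
        scaleR_diff_right[symmetric] add_diff_cancel_left)
  also have "(?Y (Suc n) o\<^sub>L ?Y (Suc n)) - (?Y n o\<^sub>L ?Y n) = (?Y (Suc n) o\<^sub>L D) + (D o\<^sub>L ?Y n)"
    by (rule blinfun_eqI)
      (simp add: D_def blinfun.diff_left blinfun.add_left blinfun.diff_right del: sqrt_iter.simps)
  finally have eq: "?Y (Suc (Suc n)) - ?Y (Suc n) = (1/2) *\<^sub>R ((?Y (Suc n) o\<^sub>L D) + (D o\<^sub>L ?Y n))" .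
  have 1: "norm (?Y (Suc n) o\<^sub>L D) \<le> ?y (Suc n) * (?y (Suc n) - ?y n)"
    by (rule order_trans[OF norm_blinfun_compose])
      (use Suc in \<open>intro mult_mono norm_sqrt_iter_le sqrt_majorant_nonneg, auto simp: D_def\<close>)
  have 2: "norm (D o\<^sub>L ?Y n) \<le> (?y (Suc n) - ?y n) * ?y n"
    by (rule order_trans[OF norm_blinfun_compose])
      (use Suc sqrt_majorant_Suc_ge[of n] in
        \<open>intro mult_mono norm_sqrt_iter_le sqrt_majorant_nonneg, auto simp: D_def\<close>)
  have "norm (?Y (Suc (Suc n)) - ?Y (Suc n))
      \<le> (?y (Suc n) * (?y (Suc n) - ?y n) + (?y (Suc n) - ?y n) * ?y n) / 2"
    using norm_triangle_ineq[of "?Y (Suc n) o\<^sub>L D" "D o\<^sub>L ?Y n"] 1 2 unfolding eq by simp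
  also have "\<dots> = ?y (Suc (Suc n)) - ?y (Suc n)"
    by (simp only: sqrt_majorant.simps(2)[of "Suc n"] sqrt_majorant.simps(2)[of n])
      (simp add: power2_eq_square field_simps)
  finally show ?case .
qed

text \<open>In general the iteration map is only 1-Lipschitz on the unit ball, so a fixed point
  theorem for strict contractions does not apply. Instead the increments are compared with the
  telescoping series of the convergent majorant.\<close>

lemma convergent_sqrt_iter: "convergent (sqrt_iter X)"
proof -
  have "convergent sqrt_majorant"
    by (intro Bseq_mono_convergent BseqI'[where K = 1])
      (simp_all add: sqrt_majorant_le_1 sqrt_majorant_nonneg lift_Suc_mono_le[of sqrt_majorant, OF sqrt_majorant_Suc_ge]
        del: sqrt_majorant.simps)
  then have "summable (\<lambda>n. sqrt_majorant (Suc n) - sqrt_majorant n)"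
    unfolding summable_iff_convergent sum_lessThan_telescope by simp
  then have "summable (\<lambda>n. sqrt_iter X (Suc n) - sqrt_iter X n)"
    by (rule summable_comparison_test') (rule norm_sqrt_iter_diff_le)
  then show ?thesis
    unfolding summable_iff_convergent sum_lessThan_telescope by simp
qed

end

text \<open>
  The iteration \<open>Y \<mapsto> (X + Y\<^sup>2) / 2\<close> with \<open>X = 1 - A / b\<close> has a fixed point \<open>L\<close>, and then
  \<open>(1 - L)\<^sup>2 = 1 - X = A / b\<close>.
\<close>

lemma positive_op_sqrt_exists:
  fixes A :: "'a::chilbert_space \<Rightarrow> 'a"
  assumes A: "positive_op A"
  shows "\<exists>R. positive_op R \<and> R \<circ> R = A \<and>
    (\<forall>S. bounded_clinear S \<longrightarrow> S \<circ> A = A \<circ> S \<longrightarrow> S \<circ> R = R \<circ> S)"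
proof -
  have Acl: "bounded_clinear A" by (rule positive_op_bounded_clinear[OF A])
  then have Abl: "bounded_linear A" by (simp add: bounded_clinear_def)
  obtain b where b: "0 < b" "\<And>x. norm (A x) \<le> norm x * b"
    using bounded_linear.pos_bounded[OF Abl] by auto
  define X where "X = Blinfun (\<lambda>x. x - (1/b) *\<^sub>R A x)"
  have "bounded_linear (\<lambda>x. x - (1/b) *\<^sub>R A x)"
    by (intro bounded_linear_sub bounded_linear_ident bounded_linear_const_scaleR Abl)
  then have X: "blinfun_apply X x = x - (1/b) *\<^sub>R A x" for x
    unfolding X_def by (simp add: bounded_linear_Blinfun_apply)
  \<comment> \<open>Expanding \<open>(norm (X x))\<^sup>2\<close> leaves a negative term
    \<open>2 / b\<close> times the form of \<open>A\<close>; the quadratic term is at most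
    \<open>1 / b\<close> times that form by \<open>positive_op_power2_norm_le\<close>.\<close>
  have "norm X \<le> 1"
  proof (rule norm_blinfun_bound)
    fix x
    have "(norm (X x))\<^sup>2 = (norm x)\<^sup>2 - 2 / b * Re (cinner (A x) x) + (norm (A x))\<^sup>2 / b\<^sup>2"
      using positive_op_selfadjoint[OF A, of x x]
      by (simp add: X power2_norm_diff cinner_scaleR_right power_divide)
    moreover have "(norm (A x))\<^sup>2 / b\<^sup>2 \<le> 1 / b * Re (cinner (A x) x)"
      using positive_op_power2_norm_le[OF A b(2), of x] b(1)
      by (simp add: field_simps power2_eq_square)
    moreover have "0 \<le> 1 / b * Re (cinner (A x) x)"
      using positive_op_Re_nonneg[OF A] b(1) by simp
    ultimately have "(norm (X x))\<^sup>2 \<le> (norm x)\<^sup>2" by simp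
    then show "norm (X x) \<le> 1 * norm x"
      by (simp add: power2_le_iff_abs_le)
  qed simp
  note norm_X = this
  define L where "L = lim (sqrt_iter X)"
  have L: "sqrt_iter X \<longlonglongrightarrow> L"
    using convergent_sqrt_iter[OF norm_X] by (simp add: L_def convergent_LIMSEQ_iff)
  have Lx: "(\<lambda>n. sqrt_iter X n x) \<longlonglongrightarrow> L x" for x
    by (intro tendsto_intros L)
  have "L = (1/2) *\<^sub>R (X + (L o\<^sub>L L))"
  proof (rule LIMSEQ_unique)
    show "(\<lambda>n. sqrt_iter X (Suc n)) \<longlonglongrightarrow> L"
      using L by (rule LIMSEQ_Suc)
    show "(\<lambda>n. sqrt_iter X (Suc n)) \<longlonglongrightarrow> (1/2) *\<^sub>R (X + (L o\<^sub>L L))"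
      unfolding sqrt_iter.simps
      by (intro tendsto_intros bounded_bilinear.tendsto[OF bounded_bilinear_blinfun_compose] L)
  qed
  then have "2 *\<^sub>R L x = 2 *\<^sub>R ((1/2) *\<^sub>R (X + (L o\<^sub>L L))) x" for x
    by simp
  then have fix_L: "L (L x) = 2 *\<^sub>R L x - X x" for x
    by (simp add: blinfun.add_left blinfun.scaleR_left)
  have "norm L \<le> 1"
    by (rule tendsto_upperbound[OF tendsto_norm[OF L]])
      (auto intro!: always_eventually order_trans[OF norm_sqrt_iter_le[OF norm_X] sqrt_majorant_le_1])
  have iter_sa: "cinner (sqrt_iter X n x) y = cinner x (sqrt_iter X n y)" for n x y
  proof (induction n arbitrary: x y)
    case (Suc n)
    then show ?case
      by (simp add: blinfun.add_left blinfun.scaleR_left cinner_scaleR_left cinner_scaleR_right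
          cinner_add_left cinner_add_right X cinner_diff_left cinner_diff_right
          positive_op_selfadjoint[OF A])
  qed simp
  have L_sa: "cinner (L x) y = cinner x (L y)" for x y
  proof (rule LIMSEQ_unique)
    show "(\<lambda>n. cinner (sqrt_iter X n x) y) \<longlonglongrightarrow> cinner (L x) y"
      by (intro tendsto_cinner Lx tendsto_const)
    show "(\<lambda>n. cinner (sqrt_iter X n x) y) \<longlonglongrightarrow> cinner x (L y)"
      unfolding iter_sa by (intro tendsto_cinner Lx tendsto_const)
  qed
  \<comment> \<open>Each iterate is a polynomial in \<open>A\<close>. Here \<open>S\<close> is taken
    real-linear so that it may also be multiplication by a complex scalar; this is how
    \<open>L\<close>, a limit of real-linear maps, is seen to be complex-linear in
    \<open>L_scaleC\<close>.\<close>
  have iter_commute: "S (sqrt_iter X n x) = sqrt_iter X n (S x)"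
    if S: "bounded_linear S" "\<And>x. S (A x) = A (S x)" for S n x
  proof (induction n arbitrary: x)
    case 0
    then show ?case using S(1) by (simp add: linear_0 bounded_linear.linear)
  next
    case (Suc n)
    then show ?case
      using bounded_linear.linear[OF S(1)]
      by (simp add: blinfun.add_left blinfun.scaleR_left X linear_add linear_diff linear_scale S(2))
  qed
  have L_commute: "S (L x) = L (S x)" if S: "bounded_linear S" "\<And>x. S (A x) = A (S x)" for S x
  proof (rule LIMSEQ_unique)
    show "(\<lambda>n. S (sqrt_iter X n x)) \<longlonglongrightarrow> S (L x)"
      by (intro bounded_linear.tendsto[OF S(1)] Lx)
    show "(\<lambda>n. S (sqrt_iter X n x)) \<longlonglongrightarrow> L (S x)"
      unfolding iter_commute[OF S] by (rule Lx)
  qed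
  have L_scaleC: "L (c *\<^sub>C x) = c *\<^sub>C L x" for c x
    by (rule L_commute[symmetric]) (simp_all add: bounded_linear_scaleC bounded_clinear_scaleC[OF Acl])
  \<comment> \<open>Since \<open>1 - L\<close> squares to \<open>A / b\<close>, the factor
    \<open>sqrt b\<close> restores \<open>A\<close>. Positivity of \<open>R\<close> comes from
    self-adjointness of \<open>L\<close> together with \<open>norm L \<le> 1\<close>.\<close>
  define R where "R = (\<lambda>x. sqrt b *\<^sub>R (x - L x))"
  have Rbl: "bounded_linear R"
    unfolding R_def
    by (intro bounded_linear_const_scaleR bounded_linear_sub bounded_linear_ident
        blinfun.bounded_linear_right)
  have "positive_op R"
    unfolding positive_op_def bounded_clinear_def
  proof (intro conjI allI Rbl)
    show "R (c *\<^sub>C x) = c *\<^sub>C R x" for c x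
      by (simp add: R_def L_scaleC scaleC_diff_right[symmetric] scaleC_scaleR)
    fix x
    have "cnj (cinner (L x) x) = cinner (L x) x"
      using L_sa[of x x] cinner_commute[of x "L x"] by simp
    then have "Im (cinner (L x) x) = 0" by (simp add: complex_eq_iff)
    moreover have "Re (cinner (L x) x) \<le> (norm x)\<^sup>2"
    proof -
      have "Re (cinner (L x) x) \<le> norm (L x) * norm x"
        by (meson Cauchy_Schwarz_cinner complex_Re_le_cmod order_trans)
      also have "\<dots> \<le> (1 * norm x) * norm x"
        using \<open>norm L \<le> 1\<close> by (intro mult_right_mono norm_blinfun[THEN order_trans]) auto
      finally show ?thesis by (simp add: power2_eq_square)
    qed
    ultimately show "cinner (R x) x \<in> \<real>\<^sub>\<ge>\<^sub>0"
      using b(1) by (simp add: R_def cinner_scaleR_left cinner_diff_left cinner_self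
          complex_nonneg_Reals_iff)
  qed
  moreover have "R \<circ> R = A"
  proof
    fix x
    have "L (sqrt b *\<^sub>R (x - L x)) = sqrt b *\<^sub>R (L x - L (L x))"
      by (simp add: blinfun.scaleR_right blinfun.diff_right)
    then have "R (R x) = (sqrt b * sqrt b) *\<^sub>R ((x - L x) - (L x - L (L x)))"
      unfolding R_def by (simp only: scaleR_diff_right[symmetric] scaleR_scaleR)
    also have "\<dots> = b *\<^sub>R (x - 2 *\<^sub>R L x + L (L x))"
      using b(1) by (simp add: scaleR_2)
    also have "\<dots> = A x"
      using b(1) by (simp add: fix_L X)
    finally show "(R \<circ> R) x = A x" by simp
  qed
  moreover have "S \<circ> R = R \<circ> S" if S: "bounded_clinear S" "S \<circ> A = A \<circ> S" for S
  proof
    fix x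
    have bl: "bounded_linear S" using S(1) by (simp add: bounded_clinear_def)
    then have "S (L x) = L (S x)"
      by (rule L_commute) (use S(2) in \<open>simp add: fun_eq_iff\<close>)
    then show "(S \<circ> R) x = (R \<circ> S) x"
      using bounded_linear.linear[OF bl] by (simp add: R_def linear_scale linear_diff)
  qed
  ultimately show ?thesis by blast
qed

text \<open>For \<open>y = R x - S x\<close> commutation gives \<open>R y + S y = 0\<close>. The
  forms of \<open>R\<close> and \<open>S\<close> at \<open>y\<close> are nonnegative with sum zero,
  so \<open>R y\<close> and \<open>S y\<close> both vanish, and self-adjointness moves
  \<open>R - S\<close> onto \<open>y\<close> in \<open>cinner y y\<close>.\<close>

lemma commuting_positive_sqrt_eq:
  assumes R: "positive_op R" and S: "positive_op S"
    and commute: "S \<circ> R = R \<circ> S" and squares: "R \<circ> R = S \<circ> S"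
  shows "R = S"
proof
  fix x
  note cl = positive_op_bounded_clinear[OF R] positive_op_bounded_clinear[OF S]
  have comm: "S (R z) = R (S z)" and sq: "R (R z) = S (S z)" for z
    using commute squares by (simp_all add: fun_eq_iff)
  define y where "y = R x - S x"
  have "R y + S y = 0"
    by (simp add: y_def bounded_clinear_diff[OF cl(1)] bounded_clinear_diff[OF cl(2)] comm sq)
  then have "Re (cinner (R y) y) + Re (cinner (S y) y) = 0"
    by (metis cinner_add_left cinner_zero_left plus_complex.sel(1) zero_complex.sel(1))
  then have "Re (cinner (R y) y) = 0" "Re (cinner (S y) y) = 0"
    using positive_op_Re_nonneg[OF R, of y] positive_op_Re_nonneg[OF S, of y] by linarith+
  then have "R y = 0" "S y = 0"
    using positive_op_eq_0 R S by blast+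
  have "cinner y y = cinner (R x) y - cinner (S x) y"
    by (simp add: y_def cinner_diff_left)
  also have "\<dots> = cinner x (R y) - cinner x (S y)"
    by (simp add: positive_op_selfadjoint[OF R] positive_op_selfadjoint[OF S])
  also have "\<dots> = 0"
    by (simp add: \<open>R y = 0\<close> \<open>S y = 0\<close>)
  finally show "R x = S x"
    by (simp add: cinner_self y_def)
qed

text \<open>Any root \<open>S\<close> commutes with its own square \<open>A\<close>, hence with the
  constructed root \<open>R\<close> by the last clause of the existence lemma. This reduces
  uniqueness to the commuting case.\<close>

lemma positive_op_sqrt_unique:
  assumes "positive_op A"
  shows "\<exists>!R. positive_op R \<and> R \<circ> R = A"
proof -
  obtain R where R: "positive_op R" "R \<circ> R = A"
    and comm: "\<And>S. bounded_clinear S \<Longrightarrow> S \<circ> A = A \<circ> S \<Longrightarrow> S \<circ> R = R \<circ> S"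
    using positive_op_sqrt_exists[OF assms] by blast
  have "S = R" if S: "positive_op S" "S \<circ> S = A" for S
  proof -
    have "S \<circ> A = A \<circ> S"
      unfolding S(2)[symmetric] by (simp add: o_assoc)
    then have "S \<circ> R = R \<circ> S"
      by (intro comm positive_op_bounded_clinear S)
    then show ?thesis
      using commuting_positive_sqrt_eq[OF R(1) S(1)] R(2) S(2) by simp
  qed
  with R show ?thesis by blast
qed

lemma
  assumes "positive_op A"
  shows positive_op_sqrt_op: "positive_op (sqrt_op A)"
    and sqrt_op_compose: "sqrt_op A \<circ> sqrt_op A = A"
  using theI'[OF positive_op_sqrt_unique[OF assms]] by (simp_all add: sqrt_op_def)

lemma cinner_sqrt_op:
  assumes "positive_op A"
  shows "cinner (sqrt_op A x) (sqrt_op A y) = cinner (A x) y"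
  using positive_op_selfadjoint[OF positive_op_sqrt_op[OF assms], of "sqrt_op A x" y]
    sqrt_op_compose[OF assms] by (simp add: fun_eq_iff)

section \<open>Riesz representation and adjoints\<close>

definition closed_csubspace :: "'k::complex_inner set \<Rightarrow> bool" where
  "closed_csubspace K \<longleftrightarrow> closed K \<and> 0 \<in> K \<and> (\<forall>u\<in>K. \<forall>v\<in>K. u + v \<in> K) \<and> (\<forall>c. \<forall>u\<in>K. c *\<^sub>C u \<in> K)"

lemma closed_csubspaceD:
  assumes "closed_csubspace K"
  shows "closed K" "0 \<in> K" "u \<in> K \<Longrightarrow> v \<in> K \<Longrightarrow> u + v \<in> K" "u \<in> K \<Longrightarrow> c *\<^sub>C u \<in> K"
    "u \<in> K \<Longrightarrow> r *\<^sub>R u \<in> K" "u \<in> K \<Longrightarrow> v \<in> K \<Longrightarrow> u - v \<in> K"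
proof -
  show "u - v \<in> K" if "u \<in> K" "v \<in> K"
    using assms that scaleC_minus_one[of v] unfolding closed_csubspace_def
    by (metis add_uminus_conv_diff)
qed (use assms in \<open>auto simp: closed_csubspace_def scaleR_scaleC\<close>)

text \<open>The representing vector minimises \<open>\<lambda>k. (norm k)\<^sup>2 - 2 * Re (f k)\<close> over \<open>K\<close>.\<close>

lemma riesz_closed_csubspace:
  fixes K :: "'k::chilbert_space set"
  assumes K: "closed_csubspace K"
    and add: "\<And>u v. u \<in> K \<Longrightarrow> v \<in> K \<Longrightarrow> f (u + v) = f u + f v"
    and scale: "\<And>c u. u \<in> K \<Longrightarrow> f (c *\<^sub>C u) = c * f u"
    and bound: "\<And>u. u \<in> K \<Longrightarrow> cmod (f u) \<le> M * norm u"
  shows "\<exists>u\<in>K. \<forall>k\<in>K. f k = cinner k u"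
proof -
  note Kcl = closed_csubspaceD[OF K]
  have scaleR: "f (r *\<^sub>R u) = r *\<^sub>R f u" if "u \<in> K" for r u
    using scale[OF that] by (simp add: scaleR_scaleC scaleR_conv_of_real)
  have diff: "f (u - v) = f u - f v" if "u \<in> K" "v \<in> K" for u v
    using add[OF that(1) Kcl(5)[OF that(2), of "-1"]] scaleR[OF that(2), of "-1"] by simp
  define p where "p = (\<lambda>k. (norm k)\<^sup>2 - 2 * Re (f k))"
  \<comment> \<open>Completing the square in \<open>norm k\<close> shows that the functional is
    bounded below.\<close>
  have p_ge: "- M\<^sup>2 \<le> p k" if "k \<in> K" for k
  proof -
    have "Re (f k) \<le> M * norm k"
      using bound[OF that] complex_Re_le_cmod[of "f k"] by linarith
    moreover have "0 \<le> (norm k - M)\<^sup>2" by simp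
    ultimately show ?thesis by (simp add: p_def power2_diff algebra_simps)
  qed
  then have bdd: "bdd_below (p ` K)" by (intro bdd_belowI2[of K "- M\<^sup>2"])
  define m where "m = (INF k\<in>K. p k)"
  have m_le: "m \<le> p k" if "k \<in> K" for k
    unfolding m_def by (rule cINF_lower[OF bdd that])
  have "\<exists>k\<in>K. p k < m + e" if "0 < e" for e
    using cINF_less_iff[OF _ bdd, of "m + e"] Kcl(2) that by (auto simp: m_def)
  then have "\<exists>k\<in>K. p k < m + 1 / real (Suc n)" for n
    by simp
  then obtain k where k: "\<And>n. k n \<in> K" "\<And>n. p (k n) < m + 1 / real (Suc n)"
    by metis
  \<comment> \<open>With \<open>w\<close> the midpoint, the parallelogram law reads
    \<open>(norm (u - v))\<^sup>2 = 2 * p u + 2 * p v - 4 * p w\<close>, because the linear parts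
    cancel. Hence minimising sequences are Cauchy.\<close>
  have close: "(norm (u - v))\<^sup>2 \<le> 2 * (p u - m) + 2 * (p v - m)" if "u \<in> K" "v \<in> K" for u v
  proof -
    define w where "w = (1/2) *\<^sub>R (u + v)"
    have "(norm (u + v))\<^sup>2 = 4 * (norm w)\<^sup>2"
      by (simp add: w_def power_divide)
    moreover have "2 * Re (f w) = Re (f u) + Re (f v)"
      using scaleR[OF Kcl(3)[OF that], of "1/2"] add[OF that] by (simp add: w_def)
    moreover have "m \<le> p w"
      unfolding w_def by (intro m_le Kcl that)
    ultimately show ?thesis
      using parallelogram_law[of u v] unfolding p_def by argo
  qed
  have "Cauchy k"
  proof (rule metric_CauchyI)
    fix e :: real
    assume "0 < e"
    then obtain N where N: "1 / real (Suc N) < e\<^sup>2 / 4"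
      using nat_approx_posE[of "e\<^sup>2 / 4"] by auto
    have "dist (k i) (k l) < e" if "N \<le> i" "N \<le> l" for i l
    proof -
      have "1 / real (Suc i) \<le> 1 / real (Suc N)" "1 / real (Suc l) \<le> 1 / real (Suc N)"
        using that by (auto intro!: divide_left_mono)
      then have "(norm (k i - k l))\<^sup>2 < e\<^sup>2"
        using close[OF k(1) k(1), of i l] k(2)[of i] k(2)[of l] N by argo
      then show ?thesis
        using \<open>0 < e\<close> by (simp add: dist_norm power_less_imp_less_base)
    qed
    then show "\<exists>N. \<forall>i\<ge>N. \<forall>l\<ge>N. dist (k i) (k l) < e" by blast
  qed
  then obtain u where u: "k \<longlonglongrightarrow> u"
    using Cauchy_convergent_iff convergent_def by blast
  have uK: "u \<in> K"
    by (rule closed_sequentially[OF Kcl(1) _ u]) (rule k(1))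
  have "(\<lambda>n. f (k n) - f u) \<longlonglongrightarrow> 0"
  proof (rule Lim_null_comparison)
    show "\<forall>\<^sub>F n in sequentially. norm (f (k n) - f u) \<le> M * norm (k n - u)"
      using bound[OF Kcl(6)[OF k(1) uK]] by (simp add: diff k(1) uK)
    show "(\<lambda>n. M * norm (k n - u)) \<longlonglongrightarrow> 0"
      using tendsto_mult_right_zero[OF tendsto_norm_zero[OF LIM_zero[OF u]]] by simp
  qed
  then have "(\<lambda>n. f (k n)) \<longlonglongrightarrow> f u"
    by (rule LIM_zero_cancel)
  then have "(\<lambda>n. p (k n)) \<longlonglongrightarrow> p u"
    unfolding p_def by (intro tendsto_intros u)
  moreover have "(\<lambda>n. m + 1 / real (Suc n)) \<longlonglongrightarrow> m + 0"
    by (intro tendsto_intros LIMSEQ_Suc[OF lim_1_over_n])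
  ultimately have "p u \<le> m + 0"
    by (rule LIMSEQ_le) (use k(2) less_imp_le in blast)
  then have min: "p u \<le> p v" if "v \<in> K" for v
    using m_le[OF that] by simp
  \<comment> \<open>First variation at the minimiser: \<open>p (u + t v) - p u\<close> is the
    quadratic in \<open>var\<close>, and it can be nonnegative for all real \<open>t\<close> only if
    \<open>d = 0\<close>. Imaginary parts follow afterwards by replacing \<open>v\<close> with
    \<open>\<i> *\<^sub>C v\<close>.\<close>
  have Re_eq: "Re (f v) = Re (cinner v u)" if v: "v \<in> K" for v
  proof -
    define d where "d = Re (cinner u v) - Re (f v)"
    have var: "0 \<le> 2 * t * d + t\<^sup>2 * (norm v)\<^sup>2" for t
      using min[OF Kcl(3)[OF uK Kcl(5)[OF v, of t]]]
      by (simp add: p_def power2_norm_add add[OF uK Kcl(5)[OF v]] scaleR[OF v] cinner_scaleR_right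
          d_def power_mult_distrib algebra_simps)
    have "d = 0"
    proof (cases "norm v = 0")
      case True
      then show ?thesis using var[of "- d"] by (auto simp: mult_le_0_iff)
    next
      case False
      then show ?thesis using var[of "- d / (norm v)\<^sup>2"]
        by (auto simp: field_simps power2_eq_square mult_le_0_iff)
    qed
    then show ?thesis
      by (subst cinner_commute) (simp add: d_def)
  qed
  have "f v = cinner v u" if v: "v \<in> K" for v
    using Re_eq[OF v] Re_eq[OF Kcl(4)[OF v, of "\<i>"]]
    by (simp add: scale[OF v] cinner_scaleC_left complex_eq_iff)
  with uK show ?thesis by blast
qed

section \<open>Adjoints of contractions on a closed subspace\<close>

context
  fixes K :: "'k::chilbert_space set" and S :: "'k \<Rightarrow> 'a::chilbert_space"
  assumes K: "closed_csubspace K" and S: "contraction_on K S"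
begin

lemma contraction_onD:
  shows "u \<in> K \<Longrightarrow> v \<in> K \<Longrightarrow> S (u + v) = S u + S v" "u \<in> K \<Longrightarrow> S (c *\<^sub>C u) = c *\<^sub>C S u"
    "u \<in> K \<Longrightarrow> norm (S u) \<le> norm u"
  using S by (auto simp: contraction_on_def)

text \<open>Contractivity bounds the functional \<open>\<lambda>k. cinner (S k) y\<close> by
  \<open>norm y\<close>, so Riesz applies. Two representing vectors differ by an element of
  \<open>K\<close> that is orthogonal to itself.\<close>

lemma adjoint_on_ex1: "\<exists>!u. u \<in> K \<and> (\<forall>k\<in>K. cinner (S k) y = cinner k u)"
proof (rule ex_ex1I)
  have "cmod (cinner (S u) y) \<le> norm y * norm u" if "u \<in> K" for u
    using order_trans[OF Cauchy_Schwarz_cinner mult_right_mono[OF contraction_onD(3)[OF that]]]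
    by (simp add: mult.commute)
  then show "\<exists>u. u \<in> K \<and> (\<forall>k\<in>K. cinner (S k) y = cinner k u)"
    using riesz_closed_csubspace[OF K, of "\<lambda>k. cinner (S k) y" "norm y"]
    by (auto simp: contraction_onD cinner_add_left cinner_scaleC_left)
next
  fix u v
  assume u: "u \<in> K \<and> (\<forall>k\<in>K. cinner (S k) y = cinner k u)"
    and v: "v \<in> K \<and> (\<forall>k\<in>K. cinner (S k) y = cinner k v)"
  then have "cinner (u - v) u = cinner (u - v) v"
    using closed_csubspaceD(6)[OF K] by metis
  then have "cinner (u - v) (u - v) = 0"
    by (simp add: cinner_diff_right)
  then show "u = v" by (simp add: cinner_self)
qed

lemma
  shows adjoint_on_in: "adjoint_on K S y \<in> K"
    and cinner_adjoint_on: "k \<in> K \<Longrightarrow> cinner (S k) y = cinner k (adjoint_on K S y)"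
  using theI'[OF adjoint_on_ex1[of y]] by (auto simp: adjoint_on_def)

lemma adjoint_on_eqI:
  "u \<in> K \<Longrightarrow> (\<And>k. k \<in> K \<Longrightarrow> cinner (S k) y = cinner k u) \<Longrightarrow> adjoint_on K S y = u"
  unfolding adjoint_on_def by (rule the1_equality[OF adjoint_on_ex1]) auto

lemma bounded_clinear_adjoint_on: "bounded_clinear (adjoint_on K S)"
proof (rule bounded_clinearI)
  show "adjoint_on K S (x + y) = adjoint_on K S x + adjoint_on K S y" for x y
    by (intro adjoint_on_eqI closed_csubspaceD(3)[OF K] adjoint_on_in)
      (simp add: cinner_add_right cinner_adjoint_on)
  show "adjoint_on K S (c *\<^sub>C x) = c *\<^sub>C adjoint_on K S x" for c x
    by (intro adjoint_on_eqI closed_csubspaceD(4)[OF K] adjoint_on_in)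
      (simp add: cinner_scaleC_right cinner_adjoint_on)
  show "norm (adjoint_on K S x) \<le> norm x * 1" for x
  proof -
    let ?u = "adjoint_on K S x"
    have "complex_of_real ((norm ?u)\<^sup>2) = cinner (S ?u) x"
      by (simp add: cinner_adjoint_on[OF adjoint_on_in] cinner_self)
    then have "(norm ?u)\<^sup>2 = cmod (cinner (S ?u) x)"
      by (metis abs_power2 norm_of_real)
    also have "\<dots> \<le> norm ?u * norm x"
      using Cauchy_Schwarz_cinner mult_right_mono[OF contraction_onD(3)[OF adjoint_on_in]]
      by (rule order_trans) simp
    finally have "norm ?u * norm ?u \<le> norm ?u * norm x"
      by (simp add: power2_eq_square)
    then show ?thesis
      by (cases "norm ?u = 0") (auto simp: mult_le_cancel_left_pos)
  qed
qed

text \<open>\<open>contraction_on\<close> controls \<open>S\<close> only on \<open>K\<close>;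
  factoring through a map into \<open>K\<close> gives an operator on the whole space. With an
  adjoint as \<open>T\<close> this covers the middle factors of both formulas for the parallel
  sum.\<close>

lemma bounded_clinear_contraction_compose:
  assumes T: "bounded_clinear T" and TK: "\<And>x. T x \<in> K"
  shows "bounded_clinear (S \<circ> T)"
proof -
  obtain M where M: "\<And>x. norm (T x) \<le> norm x * M"
    using T bounded_linear.bounded[of T] by (auto simp: bounded_clinear_def)
  show ?thesis
    by (rule bounded_clinearI[of _ M])
      (simp_all add: bounded_clinear_add[OF T] bounded_clinear_scaleC[OF T] contraction_onD TK
        order_trans[OF contraction_onD(3)[OF TK] M])
qed

end

section \<open>Contractions determined on a dense subspace\<close>

text \<open>Extension by continuity, parametrised by \<open>x\<close> instead of by points of the
  dense range; later \<open>e x = j (C x)\<close> and \<open>R\<close> is a square root. The bound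
  \<open>le\<close> makes \<open>R\<close> factor through \<open>e\<close> and the resulting map
  1-Lipschitz, so it extends to the closure. Linearity and the norm bound pass to limits.\<close>

lemma contraction_extension_ex1:
  fixes e :: "'h::chilbert_space \<Rightarrow> 'k::chilbert_space" and R :: "'h \<Rightarrow> 'a::chilbert_space"
  assumes e: "\<And>x y. e (x + y) = e x + e y" "\<And>c x. e (c *\<^sub>C x) = c *\<^sub>C e x"
    and R: "\<And>x y. R (x + y) = R x + R y" "\<And>c x. R (c *\<^sub>C x) = c *\<^sub>C R x"
    and le: "\<And>x. norm (R x) \<le> norm (e x)"
    and K: "closure (range e) = K"
  shows "closed_csubspace K"
    and "\<exists>!S. S \<in> extensional K \<and> contraction_on K S \<and> (\<forall>x. S (e x) = R x)"
proof -
  have approx: "\<exists>x. (\<lambda>n. e (x n)) \<longlonglongrightarrow> u" if u: "u \<in> K" for u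
  proof -
    obtain v where v: "\<And>n. v n \<in> range e" "v \<longlonglongrightarrow> u"
      using u closure_sequential[of u "range e"] K by metis
    have "v = (\<lambda>n. e (inv e (v n)))"
      using f_inv_into_f[OF v(1)] by simp
    with v(2) have "(\<lambda>n. e (inv e (v n))) \<longlonglongrightarrow> u" by simp
    then show ?thesis by (intro exI[of _ "\<lambda>n. inv e (v n)"])
  qed
  have lim_in: "u \<in> K" if "(\<lambda>n. e (x n)) \<longlonglongrightarrow> u" for x u
    using that closure_sequential[of u "range e"] K by (metis rangeI)
  have e_in: "e x \<in> K" for x
    using closure_subset[of "range e"] K by blast
  have e0: "e 0 = 0" using e(1)[of 0 0] by simp
  have lim_add: "(\<lambda>n. e (x n + y n)) \<longlonglongrightarrow> u + v"
    if "(\<lambda>n. e (x n)) \<longlonglongrightarrow> u" "(\<lambda>n. e (y n)) \<longlonglongrightarrow> v" for x y u v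
    using that unfolding e(1) by (rule tendsto_add)
  have lim_scale: "(\<lambda>n. e (c *\<^sub>C x n)) \<longlonglongrightarrow> c *\<^sub>C u"
    if "(\<lambda>n. e (x n)) \<longlonglongrightarrow> u" for c x u
    using that unfolding e(2) by (rule tendsto_scaleC)
  show cs: "closed_csubspace K"
    unfolding closed_csubspace_def
  proof (intro conjI ballI allI)
    show "closed K" using K by auto
    show "0 \<in> K" using e_in[of 0] e0 by simp
    show "u + v \<in> K" if uv: "u \<in> K" "v \<in> K" for u v
    proof -
      obtain x y where "(\<lambda>n. e (x n)) \<longlonglongrightarrow> u" "(\<lambda>n. e (y n)) \<longlonglongrightarrow> v"
        using approx[OF uv(1)] approx[OF uv(2)] by blast
      from lim_in[OF lim_add[OF this]] show ?thesis .
    qed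
    show "c *\<^sub>C u \<in> K" if u: "u \<in> K" for c u
    proof -
      obtain x where "(\<lambda>n. e (x n)) \<longlonglongrightarrow> u"
        using approx[OF u] by blast
      from lim_in[OF lim_scale[OF this]] show ?thesis .
    qed
  qed
  have e_diff: "e (x - y) = e x - e y" and R_diff: "R (x - y) = R x - R y" for x y
    using e(1)[of "x - y" y] R(1)[of "x - y" y] by simp_all
  have lip: "norm (R x - R y) \<le> norm (e x - e y)" for x y
    using le[of "x - y"] by (simp add: e_diff R_diff)
  \<comment> \<open>The choice of preimage by \<open>inv e\<close> is immaterial: by
    \<open>lip\<close>, points with equal image under \<open>e\<close> have equal image under
    \<open>R\<close>.\<close>
  define g where "g = (\<lambda>k. R (inv e k))"
  have g: "g (e x) = R x" for x
    using lip[of "inv e (e x)" x] by (simp add: g_def f_inv_into_f)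
  have "uniformly_continuous_on (range e) g"
    unfolding uniformly_continuous_on_def
  proof (intro allI impI)
    fix d :: real
    assume "0 < d"
    then show "\<exists>r>0. \<forall>x\<in>range e. \<forall>x'\<in>range e. dist x' x < r \<longrightarrow> dist (g x') (g x) < d"
      using lip by (intro exI[of _ d]) (auto simp: g dist_norm intro: order.strict_trans1)
  qed
  then obtain G where G: "uniformly_continuous_on K G" "\<And>k. k \<in> range e \<Longrightarrow> g k = G k"
    using uniformly_continuous_on_extension_on_closure[of "range e" g] K by metis
  have Ge: "G (e x) = R x" for x
    using G(2)[of "e x"] g by simp
  have Glim: "(\<lambda>n. R (x n)) \<longlonglongrightarrow> G u" if "(\<lambda>n. e (x n)) \<longlonglongrightarrow> u" for x u
    using continuous_on_tendsto_compose[OF uniformly_continuous_imp_continuous[OF G(1)] that lim_in[OF that]]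
      e_in by (simp add: Ge)
  have G_contraction: "contraction_on K G"
    unfolding contraction_on_def
  proof (intro conjI ballI allI)
    fix u
    assume u: "u \<in> K"
    then obtain x where x: "(\<lambda>n. e (x n)) \<longlonglongrightarrow> u" using approx by blast
    show "norm (G u) \<le> norm u"
      by (rule LIMSEQ_le[OF tendsto_norm[OF Glim[OF x]] tendsto_norm[OF x]]) (use le in blast)
    show "G (c *\<^sub>C u) = c *\<^sub>C G u" for c
      using Glim[OF lim_scale[OF x]] tendsto_scaleC[OF Glim[OF x]]
      unfolding R(2) by (rule LIMSEQ_unique)
    fix v
    assume "v \<in> K"
    then obtain y where y: "(\<lambda>n. e (y n)) \<longlonglongrightarrow> v" using approx by blast
    show "G (u + v) = G u + G v"
      using Glim[OF lim_add[OF x y]] tendsto_add[OF Glim[OF x] Glim[OF y]]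
      unfolding R(1) by (rule LIMSEQ_unique)
  qed
  show "\<exists>!S. S \<in> extensional K \<and> contraction_on K S \<and> (\<forall>x. S (e x) = R x)"
  proof (rule ex1I)
    have "contraction_on K (restrict G K)"
      using G_contraction closed_csubspaceD[OF cs] by (simp add: contraction_on_def)
    then show "restrict G K \<in> extensional K \<and> contraction_on K (restrict G K)
        \<and> (\<forall>x. restrict G K (e x) = R x)"
      by (simp add: Ge e_in)
  next
    fix S
    assume S: "S \<in> extensional K \<and> contraction_on K S \<and> (\<forall>x. S (e x) = R x)"
    then have Sc: "contraction_on K S" by blast
    show "S = restrict G K"
    proof (rule extensionalityI[of _ K])
      fix u
      assume u: "u \<in> K"
      then obtain x where x: "(\<lambda>n. e (x n)) \<longlonglongrightarrow> u" using approx by blast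
      \<comment> \<open>Contractivity of \<open>S\<close> at \<open>e (x n) - u\<close> forces
        \<open>S u\<close> to be the limit of \<open>R (x n)\<close>, which is also
        \<open>G u\<close>.\<close>
      have "S (k - u) = S k - S u" if "k \<in> K" for k
        using contraction_onD(1)[OF cs Sc closed_csubspaceD(6)[OF cs that u] u] by simp
      then have "norm (R (x n) - S u) \<le> norm (e (x n) - u)" for n
        using contraction_onD(3)[OF cs Sc closed_csubspaceD(6)[OF cs e_in u], of "x n"] S e_in
        by simp
      then have "(\<lambda>n. R (x n) - S u) \<longlonglongrightarrow> 0"
        by (intro Lim_null_comparison[OF _ tendsto_norm_zero[OF LIM_zero[OF x]]]) simp
      then have "(\<lambda>n. R (x n)) \<longlonglongrightarrow> S u"
        by (rule LIM_zero_cancel)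
      then show "S u = restrict G K u"
        using LIMSEQ_unique[OF _ Glim[OF x]] u by simp
    qed (use S in auto)
  qed
qed

text \<open>The domination \<open>le\<close> is exactly the norm bound of the extension lemma: the
  form of \<open>A\<close> at \<open>x\<close> is \<open>(norm (sqrt_op A x))\<^sup>2\<close>, and
  the form of \<open>C\<close> at \<open>x\<close> is
  \<open>(norm (j (C x)))\<^sup>2\<close>.\<close>

lemma sqrt_contraction_props:
  fixes A C :: "'h::chilbert_space \<Rightarrow> 'h" and K :: "'k::chilbert_space set"
  assumes A: "positive_op A" and C: "bounded_clinear C"
    and le: "\<And>x. Re (cinner (A x) x) \<le> Re (cinner (C x) x)"
    and compl: "range_completion C K j"
  shows "closed_csubspace K"
    and "contraction_on K (sqrt_contraction C K j A)"
    and "sqrt_contraction C K j A (j (C x)) = sqrt_op A x"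
proof -
  have j: "j (C x + C y) = j (C x) + j (C y)" "j (c *\<^sub>C C x) = c *\<^sub>C j (C x)"
    "cinner (j (C x)) (j (C y)) = cinner (C x) y" for x y c
    using compl by (simp_all add: range_completion_def)
  have dense: "closure (range (\<lambda>x. j (C x))) = K"
    using compl by (simp add: range_completion_def image_image)
  have R: "bounded_clinear (sqrt_op A)"
    by (intro positive_op_bounded_clinear positive_op_sqrt_op A)
  have "(norm (sqrt_op A x))\<^sup>2 \<le> (norm (j (C x)))\<^sup>2" for x
    using le[of x] cinner_sqrt_op[OF A, of x x] j(3)[of x x] unfolding cinner_self
    by (metis Re_complex_of_real)
  then have "norm (sqrt_op A x) \<le> norm (j (C x))" for x
    by (rule power2_le_imp_le) simp
  note ext = contraction_extension_ex1[of "\<lambda>x. j (C x)" "sqrt_op A", OF _ _ _ _ this dense]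
  show "closed_csubspace K"
    by (rule ext(1)) (simp_all add: bounded_clinear_add[OF C] bounded_clinear_scaleC[OF C] j
        bounded_clinear_add[OF R] bounded_clinear_scaleC[OF R])
  have "\<exists>!S. S \<in> extensional K \<and> contraction_on K S \<and> (\<forall>x. S (j (C x)) = sqrt_op A x)"
    by (rule ext(2)) (simp_all add: bounded_clinear_add[OF C] bounded_clinear_scaleC[OF C] j
        bounded_clinear_add[OF R] bounded_clinear_scaleC[OF R])
  from theI'[OF this]
  show "contraction_on K (sqrt_contraction C K j A)"
    and "sqrt_contraction C K j A (j (C x)) = sqrt_op A x"
    by (simp_all add: sqrt_contraction_def)
qed

section \<open>The parallel sum\<close>

text \<open>Positivity of \<open>P\<close> is automatic, as the infimum is taken over nonnegative
  numbers, and the quadratic form determines the operator. Each candidate is thus reduced to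
  boundedness, linearity and the form identity.\<close>

lemma parallel_sum_eqI:
  assumes A: "positive_op A" and B: "positive_op B" and P: "bounded_clinear P"
    and form: "\<And>x. cinner (P x) x =
        complex_of_real (INF y. Re (cinner (A (x - y)) (x - y) + cinner (B y) y))"
  shows "parallel_sum A B = P"
  unfolding parallel_sum_def
proof (rule the_equality)
  have "0 \<le> (INF y. Re (cinner (A (x - y)) (x - y) + cinner (B y) y))" for x
    by (rule cINF_greatest) (simp_all add: positive_op_Re_nonneg[OF A] positive_op_Re_nonneg[OF B])
  with P show "positive_op P \<and> (\<forall>x. cinner (P x) x =
      complex_of_real (INF y. Re (cinner (A (x - y)) (x - y) + cinner (B y) y)))"
    by (simp add: positive_op_def form)
next
  fix Q
  assume "positive_op Q \<and> (\<forall>x. cinner (Q x) x =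
      complex_of_real (INF y. Re (cinner (A (x - y)) (x - y) + cinner (B y) y)))"
  then show "Q = P"
    by (intro bounded_clinear_eqI positive_op_bounded_clinear P) (simp_all add: form)
qed

theorem theorem2p3:
  fixes A B :: "'h::chilbert_space \<Rightarrow> 'h"
    and K :: "'k::chilbert_space set"
    and j :: "'h \<Rightarrow> 'k"
  assumes "positive_op A" and "positive_op B"
    and "range_completion (\<lambda>x. A x + B x) K j"
  shows "let S\<^sub>A = sqrt_contraction (\<lambda>x. A x + B x) K j A;
             S\<^sub>B = sqrt_contraction (\<lambda>x. A x + B x) K j B
         in parallel_sum A B = sqrt_op A \<circ> S\<^sub>A \<circ> adjoint_on K S\<^sub>B \<circ> sqrt_op B
          \<and> parallel_sum A B = sqrt_op B \<circ> S\<^sub>B \<circ> adjoint_on K S\<^sub>A \<circ> sqrt_op A"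
proof -
  note A = assms(1) and B = assms(2)
  define C where "C = (\<lambda>x. A x + B x)"
  note compl = assms(3)[folded C_def]
  define SA SB where "SA = sqrt_contraction C K j A" and "SB = sqrt_contraction C K j B"
  note Acl = positive_op_bounded_clinear[OF A] and Bcl = positive_op_bounded_clinear[OF B]
  have C: "bounded_clinear C"
    using Acl Bcl unfolding bounded_clinear_def C_def
    by (auto simp: scaleC_add_right intro: bounded_linear_add)
  have "Re (cinner (A x) x) \<le> Re (cinner (C x) x)" "Re (cinner (B x) x) \<le> Re (cinner (C x) x)" for x
    by (simp_all add: C_def cinner_add_left positive_op_Re_nonneg[OF A] positive_op_Re_nonneg[OF B])
  note SA = sqrt_contraction_props[OF A C this(1) compl, folded SA_def]
    and SB = sqrt_contraction_props[OF B C this(2) compl, folded SB_def]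
  note K = SA(1)
  have dense: "closure (range (\<lambda>x. j (C x))) = K"
    and j: "cinner (j (C x)) (j (C y)) = cinner (C x) y" for x y
    using compl by (simp_all add: range_completion_def image_image)
  have j_in: "j (C x) \<in> K" for x
    using closure_subset[of "range (\<lambda>x. j (C x))"] dense by blast
  define a b where "a = (\<lambda>x. adjoint_on K SA (sqrt_op A x))"
    and "b = (\<lambda>x. adjoint_on K SB (sqrt_op B x))"
  have ab_in: "a x \<in> K" "b x \<in> K" for x
    using adjoint_on_in[OF K SA(2)] adjoint_on_in[OF K SB(2)] by (simp_all add: a_def b_def)
  have j_b: "cinner (j (C y)) (b x) = cinner (B y) x" for x y
    unfolding b_def
    by (simp add: cinner_adjoint_on[OF K SB(2) j_in, symmetric] SB(3) cinner_sqrt_op[OF B])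
  have j_a: "cinner (j (C y)) (a x) = cinner (A y) x" for x y
    unfolding a_def
    by (simp add: cinner_adjoint_on[OF K SA(2) j_in, symmetric] SA(3) cinner_sqrt_op[OF A])
  \<comment> \<open>The defect \<open>d\<close> is orthogonal to the dense range, hence by
    continuity to all of \<open>K\<close>, hence to itself.\<close>
  have a_eq: "a x = j (C x) - b x" for x
  proof -
    define d where "d = j (C x) - b x - a x"
    have "d \<in> K" unfolding d_def by (intro closed_csubspaceD(6)[OF K] j_in ab_in)
    have "cinner k d = 0" if "k \<in> K" for k
    proof -
      have "closed {k. cinner k d = 0}"
        by (intro closed_Collect_eq continuous_intros
            linear_continuous_on bounded_bilinear.bounded_linear_left[OF bounded_bilinear_cinner])
      moreover have "cinner (j (C y)) d = 0" for y
        by (simp add: d_def cinner_diff_right j j_a j_b) (simp add: C_def cinner_add_left)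
      ultimately have "closure (range (\<lambda>x. j (C x))) \<subseteq> {k. cinner k d = 0}"
        by (intro closure_minimal) auto
      then show ?thesis using that dense by blast
    qed
    from this[OF \<open>d \<in> K\<close>] show ?thesis by (simp add: d_def cinner_self)
  qed
  define q where "q = (\<lambda>x. Re (cinner (B x) x) - (norm (b x))\<^sup>2)"
  have b_a: "cinner (b x) (a x) = complex_of_real (q x)" for x
  proof -
    have "cinner (b x) (j (C x)) = cnj (cinner (B x) x)"
      by (subst cinner_commute) (simp add: j_b)
    also have "\<dots> = complex_of_real (Re (cinner (B x) x))"
      by (simp add: complex_eq_iff positive_op_Im[OF B])
    finally show ?thesis
      by (simp add: a_eq cinner_diff_right cinner_self q_def)
  qed
  \<comment> \<open>As \<open>q x\<close> is real, exchanging the two vectors changes nothing;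
    therefore both operator products have the same quadratic form.\<close>
  then have a_b: "cinner (a x) (b x) = complex_of_real (q x)" for x
    by (subst cinner_commute) simp
  have inf: "(INF y. Re (cinner (A (x - y)) (x - y) + cinner (B y) y)) = q x" for x
  proof -
    \<comment> \<open>In terms of \<open>z = x - y\<close> the sum of the two forms is the form of
      \<open>C\<close> at \<open>z\<close>, minus \<open>2 * Re (cinner (B z) x)\<close>, plus the
      form of \<open>B\<close> at \<open>x\<close>. Completing the square in the completion isolates
      \<open>q x\<close>.\<close>
    have form: "Re (cinner (A (x - y)) (x - y) + cinner (B y) y)
        = (norm (b x - j (C (x - y))))\<^sup>2 + q x" for y
    proof -
      define z where "z = x - y"
      have "Re (cinner (B (x - z)) (x - z))
          = Re (cinner (B x) x) - 2 * Re (cinner (B z) x) + Re (cinner (B z) z)"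
      proof -
        have "Re (cinner (B x) z) = Re (cinner (B z) x)"
          by (subst cinner_commute) (simp add: positive_op_selfadjoint[OF B])
        then show ?thesis
          by (simp add: bounded_clinear_diff[OF Bcl] cinner_diff_left cinner_diff_right)
      qed
      moreover have "(norm (b x - j (C z)))\<^sup>2
          = (norm (b x))\<^sup>2 - 2 * Re (cinner (B z) x) + Re (cinner (C z) z)"
      proof -
        have "(norm (j (C z)))\<^sup>2 = Re (cinner (C z) z)"
          using arg_cong[OF cinner_self[of "j (C z)"], of Re] by (simp add: j)
        then show ?thesis
          using power2_norm_diff[of "j (C z)" "b x"] by (simp add: norm_minus_commute j_b)
      qed
      moreover have "y = x - z" by (simp add: z_def)
      ultimately show ?thesis
        by (simp add: q_def C_def cinner_add_left flip: z_def)
    qed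
    show ?thesis
    proof (rule cInf_eq_non_empty)
      show "q x \<le> r" if "r \<in> range (\<lambda>y. Re (cinner (A (x - y)) (x - y) + cinner (B y) y))" for r
        using that by (auto simp only: form) simp
      show "r \<le> q x"
        if r: "\<And>s. s \<in> range (\<lambda>y. Re (cinner (A (x - y)) (x - y) + cinner (B y) y)) \<Longrightarrow> r \<le> s" for r
      proof (rule field_le_epsilon)
        fix \<epsilon> :: real
        assume "0 < \<epsilon>"
        moreover have "b x \<in> closure (range (\<lambda>z. j (C z)))"
          using ab_in dense by simp
        ultimately obtain z where z: "dist (j (C z)) (b x) < sqrt \<epsilon>"
          unfolding closure_approachable by (metis real_sqrt_gt_zero rangeE)
        then have "(norm (b x - j (C z)))\<^sup>2 < (sqrt \<epsilon>)\<^sup>2"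
          by (intro power_strict_mono) (simp_all add: dist_norm norm_minus_commute)
        \<comment> \<open>The competitor is \<open>y = x - z\<close>, for which \<open>x - y\<close>
          is the approximating \<open>z\<close>.\<close>
        moreover have "r \<le> (norm (b x - j (C (x - (x - z)))))\<^sup>2 + q x"
          unfolding form[symmetric] by (rule r) blast
        ultimately show "r \<le> q x + \<epsilon>"
          using \<open>0 < \<epsilon>\<close> by simp
      qed
    qed simp
  qed
  note sqrtA = positive_op_sqrt_op[OF A] and sqrtB = positive_op_sqrt_op[OF B]
  have "parallel_sum A B = sqrt_op A \<circ> (SA \<circ> adjoint_on K SB) \<circ> sqrt_op B"
  proof (rule parallel_sum_eqI[OF A B])
    show "bounded_clinear (sqrt_op A \<circ> (SA \<circ> adjoint_on K SB) \<circ> sqrt_op B)"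
      by (intro bounded_clinear_compose bounded_clinear_contraction_compose[OF K SA(2)]
          bounded_clinear_adjoint_on[OF K SB(2)] adjoint_on_in[OF K SB(2)]
          positive_op_bounded_clinear sqrtA sqrtB)
    \<comment> \<open>Self-adjointness moves \<open>sqrt_op A\<close> to the right-hand argument,
      and the adjoint of \<open>SA\<close> then turns the form into
      \<open>cinner (b x) (a x)\<close>.\<close>
    show "cinner ((sqrt_op A \<circ> (SA \<circ> adjoint_on K SB) \<circ> sqrt_op B) x) x =
        complex_of_real (INF y. Re (cinner (A (x - y)) (x - y) + cinner (B y) y))" for x
      unfolding inf using cinner_adjoint_on[OF K SA(2) ab_in(2), of x "sqrt_op A x"] b_a[of x]
      by (simp add: positive_op_selfadjoint[OF sqrtA] a_def b_def)
  qed
  moreover have "parallel_sum A B = sqrt_op B \<circ> (SB \<circ> adjoint_on K SA) \<circ> sqrt_op A"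
  proof (rule parallel_sum_eqI[OF A B])
    show "bounded_clinear (sqrt_op B \<circ> (SB \<circ> adjoint_on K SA) \<circ> sqrt_op A)"
      by (intro bounded_clinear_compose bounded_clinear_contraction_compose[OF K SB(2)]
          bounded_clinear_adjoint_on[OF K SA(2)] adjoint_on_in[OF K SA(2)]
          positive_op_bounded_clinear sqrtA sqrtB)
    show "cinner ((sqrt_op B \<circ> (SB \<circ> adjoint_on K SA) \<circ> sqrt_op A) x) x =
        complex_of_real (INF y. Re (cinner (A (x - y)) (x - y) + cinner (B y) y))" for x
      unfolding inf using cinner_adjoint_on[OF K SB(2) ab_in(1), of x "sqrt_op B x"] a_b[of x]
      by (simp add: positive_op_selfadjoint[OF sqrtB] a_def b_def)
  qed
  ultimately show ?thesis
    unfolding Let_def C_def[symmetric] SA_def[symmetric] SB_def[symmetric] by (simp add: o_assoc)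
qed

end
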